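(* Let $k$ be a field, let $n\ge 1$, let $G_1,\dots,G_n$ be groups, and let $G=G_1\times\dots\times G_n$ denote their direct product. (1) If the groups $G_1,\dots,G_n$ are all non-abelian, then $\mu_k(G)\ge n+1$. (2) If the groups $G_1,\dots,G_n$ are all non-solvable, then $\mu_k(G)\ge 2n$.
   Context: For a group $G$ and a field $k$, $\mu_k(G)$ denotes the minimal dimension of a faithful, finite dimensional representation of $G$ over $k$; one writes $\mu_k(G)=\infty$ if $G$ is not linear over $k$, i.e. if no such representation exists. *)

theory Defs
  imports
    "HOL-Algebra.Solvable_Groups"
    "HOL-Algebra.Product_Groups"
    "HOL-Library.Extended_Nat"
    "Jordan_Normal_Form.Matrix"
begin

definition GL :: "'k::field itself \<Rightarrow> nat \<Rightarrow> 'k mat monoid"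
  where "GL k d = units_of (ring_mat TYPE('k) d ())"

lemma group_GL: "group (GL k d)"
  unfolding GL_def
  by (intro monoid.units_group ring.is_monoid ring_mat)

definition faithful_representation ::
    "'k::field itself \<Rightarrow> ('a, 'b) monoid_scheme \<Rightarrow> nat \<Rightarrow> ('a \<Rightarrow> 'k mat) \<Rightarrow> bool"
  where "faithful_representation k G d \<rho> \<longleftrightarrow>
    \<rho> \<in> hom G (GL k d) \<and> inj_on \<rho> (carrier G)"

text \<open>The infimum of the empty set in \<^typ>\<open>enat\<close> is \<open>\<infinity>\<close>, which is the value for groups that
  are not linear over the field; on nonempty sets the infimum is attained.\<close>

definition mu :: "'k::field itself \<Rightarrow> ('a, 'b) monoid_scheme \<Rightarrow> enat"
  where "mu k G = Inf {enat d | d. \<exists>\<rho>. faithful_representation k G d \<rho>}"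

end

theory Submission
  imports
    Defs
    "HOL-Algebra.Algebraic_Closure_Type"
    "HOL-Library.Function_Algebras"
begin

text \<open>Let \<open>G = G\<^sub>1 \<times> \<dots> \<times> G\<^sub>n\<close> act faithfully on a vector space \<open>V\<close> of dimension \<open>d\<close>. After extension of
scalars the field is algebraically closed, and the factors act faithfully by pairwise commuting
groups of operators (\<open>faithful_product_representation_over_closure\<close>).

If all factors are nonabelian, each of them provides operators \<open>A\<^sub>i\<close>, \<open>B\<^sub>i\<close> with \<open>[A\<^sub>i, B\<^sub>i] \<noteq> 0\<close>,
while operators with different indices commute. As the field is infinite, there are a vector \<open>v\<close> and
a linear form \<open>f\<close> with \<open>f [A\<^sub>i, B\<^sub>i] v \<noteq> 0\<close> for all \<open>i\<close>. The form \<open>(M, N) \<mapsto> f [M, N] v\<close> is then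
symplectic on the \<open>2 n\<close>-dimensional space with basis \<open>A\<^sub>i, B\<^sub>i\<close>, and adding the identity adds its
radical. An element \<open>M\<close> of the resulting space of dimension \<open>2 n + 1\<close> with \<open>M v = 0\<close> and \<open>f M = 0\<close>
lies in the radical, hence is scalar, hence zero. These are \<open>2 d\<close> linear conditions, so
\<open>2 n + 1 \<le> 2 d\<close> and \<open>n + 1 \<le> d\<close> (\<open>card_noncommuting_pairs_less_dim\<close>).

If all factors are nonsolvable, consider a stable subspace \<open>U\<close>. A group that acts solvably on \<open>U\<close>
and on \<open>V / U\<close> acts solvably on \<open>V\<close>, because the operators that are trivial on both form an abelian
group (\<open>solvable_section_extension\<close>). So each factor stays nonsolvable on \<open>U\<close> or on \<open>V / U\<close>, and the
bound \<open>2 n\<close> follows by induction once it is known for irreducible actions. In an irreducible action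
of \<open>n\<close> commuting nonabelian groups the dimension is even at least \<open>2\<^sup>n\<close>
(\<open>dim_irreducible_noncommutative\<close>): the space is a tensor product of irreducible representations of
the factors, none of which has dimension one. Instead of tensor products, the proof uses that
\<open>V\<close> is spanned by translates of an irreducible subspace for all factors but one; a single
subspace would not suffice by Schur's lemma, and two different ones have trivial intersection.\<close>

section \<open>Linear systems and generic matrix coefficients\<close>

lemma homogeneous_system_nontrivial_solution:
  fixes M :: "'i \<Rightarrow> 'j \<Rightarrow> 'k::field"
  assumes "finite I" "finite J" "card I < card J"
  shows "\<exists>c. (\<exists>j\<in>J. c j \<noteq> 0) \<and> (\<forall>i\<in>I. (\<Sum>j\<in>J. M i j * c j) = 0)"
  using assms
proof (induction I arbitrary: J M rule: finite_induct)
  case empty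
  then obtain j where "j \<in> J" by fastforce
  then show ?case by (intro exI[of _ "\<lambda>_. 1"]) auto
next
  case (insert i I)
  show ?case
  proof (cases "\<forall>j\<in>J. M i j = 0")
    case True
    have "\<exists>c. (\<exists>j\<in>J. c j \<noteq> 0) \<and> (\<forall>i\<in>I. (\<Sum>j\<in>J. M i j * c j) = 0)"
      using insert.prems insert.hyps by (intro insert.IH) auto
    then show ?thesis using True by auto
  next
    case False
    then obtain p where p: "p \<in> J" "M i p \<noteq> 0" by blast
    define J' where "J' = J - {p}"
    \<comment> \<open>Gaussian elimination: the pivot column \<open>p\<close> is cleared using row \<open>i\<close>.\<close>
    define M' where "M' r j = M r j - M r p * M i j / M i p" for r j
    have J': "J = insert p J'" "p \<notin> J'" "finite J'"
      using p insert.prems by (auto simp: J'_def)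
    have "card I < card J'"
      using insert.prems insert.hyps J' by simp
    from insert.IH[OF J'(3) this, of M'] obtain c where
      c: "\<exists>j\<in>J'. c j \<noteq> 0" "\<And>r. r \<in> I \<Longrightarrow> (\<Sum>j\<in>J'. M' r j * c j) = 0" by blast
    define s where "s = (\<Sum>j\<in>J'. M i j * c j)"
    \<comment> \<open>The pivot unknown is recovered from row \<open>i\<close>.\<close>
    define c' where "c' = c(p := - s / M i p)"
    have sum_c': "(\<Sum>j\<in>J. M r j * c' j) = (\<Sum>j\<in>J'. M r j * c j) - M r p * s / M i p" for r
    proof -
      have "(\<Sum>j\<in>J'. M r j * c' j) = (\<Sum>j\<in>J'. M r j * c j)"
        using J'(2) by (intro sum.cong) (auto simp: c'_def)
      then show ?thesis
        unfolding J'(1) using J' by (simp add: c'_def)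
    qed
    have "(\<Sum>j\<in>J. M r j * c' j) = 0" if "r \<in> I" for r
    proof -
      have "0 = (\<Sum>j\<in>J'. M r j * c j - M r p / M i p * (M i j * c j))"
        using c(2)[OF that] by (simp add: M'_def algebra_simps)
      also have "\<dots> = (\<Sum>j\<in>J'. M r j * c j) - M r p / M i p * s"
        by (simp add: s_def sum_subtractf sum_distrib_left)
      finally show ?thesis by (simp add: sum_c')
    qed
    moreover have "(\<Sum>j\<in>J. M i j * c' j) = 0"
      using p by (simp add: sum_c' s_def)
    moreover have "\<exists>j\<in>J. c' j \<noteq> 0"
      using c(1) J' by (auto simp: c'_def)
    ultimately show ?thesis by blast
  qed
qed

text \<open>A point of the moment curve \<open>(1, t, t\<^sup>2, \<dots>)\<close> lies on the hyperplane given by a nonzero vector only if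
\<open>t\<close> is a root of a nonzero polynomial, so over an infinite field some point of the curve
avoids finitely many given hyperplanes.\<close>

lemma exists_moment_avoiding:
  fixes w :: "'i \<Rightarrow> nat \<Rightarrow> 'k::field"
  assumes "infinite (UNIV :: 'k set)" "finite I"
    and "\<And>i. i \<in> I \<Longrightarrow> \<exists>s<d. w i s \<noteq> 0"
  shows "\<exists>t. \<forall>i\<in>I. (\<Sum>s<d. w i s * t ^ s) \<noteq> 0"
proof -
  define p where "p i = (\<Sum>s<d. monom (w i s) s)" for i
  have "p i \<noteq> 0" if i: "i \<in> I" for i
  proof -
    obtain s where s: "s < d" "w i s \<noteq> 0" using assms(3)[OF i] by blast
    have "coeff (p i) s = (\<Sum>r<d. if r = s then w i r else 0)"
      by (auto simp: p_def coeff_sum intro: sum.cong)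
    also have "\<dots> = w i s" using s by simp
    finally show ?thesis using s by auto
  qed
  then have "finite (\<Union>i\<in>I. {t. poly (p i) t = 0})"
    using assms(2) by (simp add: poly_roots_finite)
  then obtain t where "t \<notin> (\<Union>i\<in>I. {t. poly (p i) t = 0})"
    using assms(1) by (metis UNIV_eq_I)
  then show ?thesis
    by (intro exI[of _ t]) (auto simp: p_def poly_sum poly_monom)
qed

text \<open>One row vector and one column vector pair nontrivially with finitely many nonzero matrices at
once: a nonzero row of each matrix is used to choose the column vector, then the nonzero images
of the column vector are used to choose the row vector.\<close>

lemma exists_generic_matrix_coefficient:
  fixes Z :: "'i \<Rightarrow> nat \<Rightarrow> nat \<Rightarrow> 'k::field"
  assumes "infinite (UNIV :: 'k set)" "finite I"
    and "\<And>i. i \<in> I \<Longrightarrow> \<exists>r<d. \<exists>s<d. Z i r s \<noteq> 0"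
  shows "\<exists>f v. \<forall>i\<in>I. (\<Sum>r<d. \<Sum>s<d. f r * Z i r s * v s) \<noteq> 0"
proof -
  obtain r where r: "\<And>i. i \<in> I \<Longrightarrow> r i < d \<and> (\<exists>s<d. Z i (r i) s \<noteq> 0)"
    using assms(3) by metis
  obtain t where t: "\<And>i. i \<in> I \<Longrightarrow> (\<Sum>s<d. Z i (r i) s * t ^ s) \<noteq> 0"
    using exists_moment_avoiding[OF assms(1,2), of d "\<lambda>i. Z i (r i)"] r by blast
  obtain u where u: "\<And>i. i \<in> I \<Longrightarrow> (\<Sum>r<d. (\<Sum>s<d. Z i r s * t ^ s) * u ^ r) \<noteq> 0"
    using exists_moment_avoiding[OF assms(1,2), of d "\<lambda>i r. \<Sum>s<d. Z i r s * t ^ s"] r t by blast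
  show ?thesis
    by (rule exI[of _ "\<lambda>r. u ^ r"], rule exI[of _ "\<lambda>s. t ^ s"])
       (use u in \<open>simp add: sum_distrib_left sum_distrib_right mult_ac\<close>)
qed

text \<open>The polynomial \<open>1 + \<Prod>\<^sub>a (X - a)\<close> over a finite field has no root.\<close>

lemma infinite_UNIV_alg_closed_field: "infinite (UNIV :: 'k::alg_closed_field set)"
proof
  assume fin: "finite (UNIV :: 'k set)"
  define q :: "'k poly" where "q = (\<Prod>a\<in>UNIV. [:-a, 1:])"
  have "degree q = card (UNIV :: 'k set)"
    unfolding q_def by (subst degree_prod_eq_sum_degree) auto
  then have "degree (q + 1) > 0"
    using fin by (subst degree_add_eq_left) (auto simp: card_gt_0_iff)
  then obtain x where "poly (q + 1) x = 0"
    using alg_closed_imp_poly_has_root by blast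
  moreover have "poly q x = 0"
    using fin by (auto simp: q_def poly_prod)
  ultimately show False by simp
qed

section \<open>Commuting families of noncommuting pairs\<close>

lemma index_mult_mat_sum:
  assumes "A \<in> carrier_mat d d" "B \<in> carrier_mat d d" "r < d" "s < d"
  shows "(A * B) $$ (r, s) = (\<Sum>l<d. A $$ (r, l) * B $$ (l, s))"
  using assms by (auto simp: scalar_prod_def lessThan_atLeast0)

text \<open>This is a variant of the dimension count for faithful representations of Heisenberg algebras. Consider a linear combination \<open>M\<close> of the \<open>2 |I| + 1\<close> matrices \<open>1, A i, B i\<close>, and
generic \<open>f\<close> and \<open>v\<close> such that \<open>f [A i, B i] v \<noteq> 0\<close> for all \<open>i\<close>. The equations \<open>M v = 0\<close> and
\<open>f M = 0\<close> are \<open>2 d\<close> linear conditions on the coefficients. If they hold, then \<open>f [N, M] v = 0\<close> for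
every \<open>N\<close>. Taking \<open>N = A i\<close> and \<open>N = B i\<close> isolates the coefficients of \<open>B i\<close> and \<open>A i\<close>, which
therefore vanish; so \<open>M\<close> is a scalar, and it is zero because \<open>M v = 0\<close> with \<open>v \<noteq> 0\<close>. Hence the
system has only the trivial solution and \<open>2 |I| + 1 \<le> 2 d\<close>.\<close>

lemma card_noncommuting_pairs_less_dim:
  fixes A B :: "'i \<Rightarrow> 'k::field mat"
  assumes inf: "infinite (UNIV :: 'k set)" and fin: "finite I" and ne: "I \<noteq> {}"
    and carrier: "\<And>i. i \<in> I \<Longrightarrow> A i \<in> carrier_mat d d" "\<And>i. i \<in> I \<Longrightarrow> B i \<in> carrier_mat d d"
    and noncomm: "\<And>i. i \<in> I \<Longrightarrow> A i * B i \<noteq> B i * A i"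
    and AA: "\<And>i j. i \<in> I \<Longrightarrow> j \<in> I \<Longrightarrow> i \<noteq> j \<Longrightarrow> A i * A j = A j * A i"
    and AB: "\<And>i j. i \<in> I \<Longrightarrow> j \<in> I \<Longrightarrow> i \<noteq> j \<Longrightarrow> A i * B j = B j * A i"
    and BB: "\<And>i j. i \<in> I \<Longrightarrow> j \<in> I \<Longrightarrow> i \<noteq> j \<Longrightarrow> B i * B j = B j * B i"
  shows "card I < d"
proof (rule ccontr)
  assume small: "\<not> card I < d"
  define Z where "Z i r s = (A i * B i) $$ (r, s) - (B i * A i) $$ (r, s)" for i r s
  have "\<exists>r<d. \<exists>s<d. Z i r s \<noteq> 0" if "i \<in> I" for i
  proof (rule ccontr)
    assume "\<not> ?thesis"
    then have "A i * B i = B i * A i"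
      using carrier[OF that] by (intro eq_matI) (auto simp: Z_def)
    then show False using noncomm that by blast
  qed
  then obtain f v where
    fv: "\<And>i. i \<in> I \<Longrightarrow> (\<Sum>r<d. \<Sum>s<d. f r * Z i r s * v s) \<noteq> 0"
    using exists_generic_matrix_coefficient[OF inf fin, of d Z] by blast
  \<comment> \<open>\<open>None\<close> indexes the identity, \<open>Some (i, True)\<close> the matrix \<open>A i\<close>
      and \<open>Some (i, False)\<close> the matrix \<open>B i\<close>.\<close>
  define M where "M a = (case a of None \<Rightarrow> 1\<^sub>m d | Some (i, b) \<Rightarrow> if b then A i else B i)"
    for a :: "('i \<times> bool) option"
  define J where "J = insert None (Some ` (I \<times> (UNIV :: bool set)))"
  have M: "M a \<in> carrier_mat d d" if "a \<in> J" for a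
    using that carrier by (auto simp: J_def M_def)
  have J: "finite J" "card J = 2 * card I + 1"
    using fin by (auto simp: J_def card_insert_if card_image card_cartesian_product)
  \<comment> \<open>With \<open>L a\<close> the row vector \<open>f M\<^sub>a\<close> and \<open>R b\<close> the column vector \<open>M\<^sub>b v\<close>, the
      scalar \<open>P a b = f M\<^sub>a M\<^sub>b v\<close> is their product.\<close>
  define P where "P a b = (\<Sum>r<d. \<Sum>s<d. f r * (M a * M b) $$ (r, s) * v s)" for a b
  define L where "L a l = (\<Sum>r<d. f r * M a $$ (r, l))" for a l
  define R where "R a l = (\<Sum>s<d. M a $$ (l, s) * v s)" for a l
  have P_LR: "P a b = (\<Sum>l<d. L a l * R b l)" if "a \<in> J" "b \<in> J" for a b
  proof -
    have "P a b = (\<Sum>r<d. \<Sum>s<d. \<Sum>l<d. f r * M a $$ (r, l) * (M b $$ (l, s) * v s))"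
      unfolding P_def using M that
      by (intro sum.cong refl)
         (simp add: index_mult_mat_sum[of _ d] sum_distrib_left sum_distrib_right mult_ac)
    also have "\<dots> = (\<Sum>r<d. \<Sum>l<d. \<Sum>s<d. f r * M a $$ (r, l) * (M b $$ (l, s) * v s))"
      by (intro sum.cong refl sum.swap)
    also have "\<dots> = (\<Sum>l<d. \<Sum>r<d. \<Sum>s<d. f r * M a $$ (r, l) * (M b $$ (l, s) * v s))"
      by (rule sum.swap)
    also have "\<dots> = (\<Sum>l<d. L a l * R b l)"
      by (simp add: L_def R_def sum_product)
    finally show ?thesis .
  qed
  \<comment> \<open>The flag \<open>True\<close> marks the \<open>d\<close> equations \<open>M v = 0\<close>, and \<open>False\<close> the \<open>d\<close> equations \<open>f M = 0\<close>.\<close>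
  have "card (UNIV \<times> {..<d} :: (bool \<times> nat) set) < card J"
    using small J by (simp add: card_cartesian_product)
  moreover have "finite (UNIV \<times> {..<d} :: (bool \<times> nat) set)"
    by simp
  ultimately obtain c where c_ne: "\<exists>a\<in>J. c a \<noteq> 0"
    and c: "\<And>x. x \<in> UNIV \<times> {..<d} \<Longrightarrow>
      (\<Sum>a\<in>J. (if fst x then R a (snd x) else L a (snd x)) * c a) = 0"
    using homogeneous_system_nontrivial_solution[OF _ J(1),
        of "UNIV \<times> {..<d}" "\<lambda>x a. if fst x then R a (snd x) else L a (snd x)"]
    by blast
  have cR: "(\<Sum>a\<in>J. R a l * c a) = 0" if "l < d" for l
    using c[of "(True, l)"] that by simp
  have cL: "(\<Sum>a\<in>J. L a l * c a) = 0" if "l < d" for l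
    using c[of "(False, l)"] that by simp
  have bracket0: "(\<Sum>b\<in>J. (P a b - P b a) * c b) = 0" if a: "a \<in> J" for a
  proof -
    have "(\<Sum>b\<in>J. (P a b - P b a) * c b)
        = (\<Sum>b\<in>J. \<Sum>l<d. L a l * (R b l * c b)) - (\<Sum>b\<in>J. \<Sum>l<d. R a l * (L b l * c b))"
      using a by (simp add: P_LR sum_subtractf[symmetric] sum_distrib_left sum_distrib_right algebra_simps)
    also have "\<dots> = (\<Sum>l<d. L a l * (\<Sum>b\<in>J. R b l * c b)) - (\<Sum>l<d. R a l * (\<Sum>b\<in>J. L b l * c b))"
      by (simp add: sum_distrib_left sum.swap[of _ J])
    also have "\<dots> = 0" using cR cL by simp
    finally show ?thesis .
  qed
  have P_comm: "P a b = P b a" if "M a * M b = M b * M a" for a b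
    using that by (simp add: P_def)
  have P_noncomm: "P (Some (i, True)) (Some (i, False)) \<noteq> P (Some (i, False)) (Some (i, True))"
    if "i \<in> I" for i
  proof -
    have "P (Some (i, True)) (Some (i, False)) - P (Some (i, False)) (Some (i, True))
        = (\<Sum>r<d. \<Sum>s<d. f r * Z i r s * v s)"
      by (simp add: P_def M_def Z_def sum_subtractf[symmetric] algebra_simps)
    then show ?thesis using fv[OF that] by auto
  qed
  have cSome: "c (Some (i, b)) = 0" if i: "i \<in> I" for i b
  proof -
    let ?a = "Some (i, \<not> b)" and ?b = "Some (i, b)"
    have mem: "?a \<in> J" "?b \<in> J" using i by (auto simp: J_def)
    \<comment> \<open>The element \<open>?a\<close> is the partner of \<open>?b\<close>, so it commutes with all the others.\<close>
    have "P ?a e = P e ?a" if e_mem: "e \<in> J" "e \<noteq> ?b" for e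
    proof (cases e)
      case None
      then show ?thesis using M[OF mem(1)] by (intro P_comm) (simp add: M_def)
    next
      case (Some jb)
      then obtain j b' where e: "e = Some (j, b')" and j: "j \<in> I"
        using e_mem(1) by (cases jb) (auto simp: J_def)
      show ?thesis
      proof (cases "j = i")
        case True
        then show ?thesis using e e_mem(2) by auto
      next
        case False
        then show ?thesis
          using i j AA AB AB[symmetric] BB by (intro P_comm) (auto simp: e M_def)
      qed
    qed
    then have "(\<Sum>e\<in>J. (P ?a e - P e ?a) * c e) = (\<Sum>e\<in>{?b}. (P ?a e - P e ?a) * c e)"
      using J(1) mem by (intro sum.mono_neutral_right) auto
    then have "(P ?a ?b - P ?b ?a) * c ?b = 0"
      using bracket0[OF mem(1)] by simp
    moreover have "P ?a ?b \<noteq> P ?b ?a"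
      using P_noncomm[OF i] by (cases b) auto
    ultimately show ?thesis by simp
  qed
  then have "c None \<noteq> 0" using c_ne by (auto simp: J_def)
  have "v l = 0" if l: "l < d" for l
  proof -
    have "(\<Sum>a\<in>J. R a l * c a) = (\<Sum>a\<in>{None}. R a l * c a)"
      using J(1) cSome by (intro sum.mono_neutral_right) (auto simp: J_def)
    then have "R None l * c None = 0" using cR[OF l] by simp
    moreover have "R None l = (\<Sum>s<d. if l = s then v s else 0)"
      unfolding R_def M_def using l by (intro sum.cong) auto
    ultimately show ?thesis using \<open>c None \<noteq> 0\<close> l by simp
  qed
  then have "(\<Sum>r<d. \<Sum>s<d. f r * Z i r s * v s) = 0" for i
    by simp
  then show False using fv ne by blast
qed

section \<open>Finite-dimensional subspaces\<close>

text \<open>Dimension is only used for subspaces of the span of a fixed finite set \<open>F\<close>; the surrounding type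
itself may be infinite-dimensional. This allows the dimension \<open>d\<close> of a representation to be a
variable: its space is the span of \<open>d\<close> unit vectors among all sequences.\<close>

locale ambient_space = vector_space scale
  for scale :: "'a::field \<Rightarrow> 'b::ab_group_add \<Rightarrow> 'b" (infixr "*s" 75) +
  fixes F :: "'b set"
  assumes finite_F: "finite F"
begin

lemma dim_strict_mono:
  assumes "V \<subseteq> span F" "subspace W" "W \<subset> V"
  shows "dim W < dim V"
proof -
  obtain B where B: "B \<subseteq> W" "independent B" "W \<subseteq> span B" "card B = dim W"
    by (rule basis_exists)
  obtain C where C: "B \<subseteq> C" "C \<subseteq> V" "independent C" "V \<subseteq> span C"
    using maximal_independent_subset_extend[of B V] B assms(3) by blast
  have finC: "finite C"
    using independent_span_bound[OF finite_F C(3)] C(2) assms(1) by blast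
  have "B \<noteq> C"
    using C(4) assms(2,3) B(1) span_minimal by blast
  then have "card B < card C"
    using C(1) finC by (intro psubset_card_mono) auto
  then show ?thesis
    using B C basis_card_eq_dim by metis
qed

lemma dim_mono_finite:
  assumes "V \<subseteq> span F" "subspace W" "W \<subseteq> V"
  shows "dim W \<le> dim V"
  using dim_strict_mono[OF assms(1-2)] assms(3) by (cases "W = V") (auto intro: less_imp_le)

text \<open>A basis of the intersection is extended to bases \<open>C\<close> and \<open>D\<close> of the two subspaces; the new part of
\<open>C\<close> stays independent together with \<open>D\<close>, because in a dependency the combination of
new elements of \<open>C\<close> would lie in the intersection, hence in the span of \<open>B\<close>.\<close>

lemma dim_add_le:
  assumes F: "V \<subseteq> span F"
    and sub: "subspace U" "subspace U'" "subspace V" and le: "U \<subseteq> V" "U' \<subseteq> V"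
  shows "dim U + dim U' \<le> dim V + dim (U \<inter> U')"
proof -
  obtain B where B: "B \<subseteq> U \<inter> U'" "independent B" "U \<inter> U' \<subseteq> span B" "card B = dim (U \<inter> U')"
    by (rule basis_exists)
  obtain C where C: "B \<subseteq> C" "C \<subseteq> U" "independent C" "U \<subseteq> span C"
    using maximal_independent_subset_extend[of B U] B by blast
  obtain D where D: "B \<subseteq> D" "D \<subseteq> U'" "independent D" "U' \<subseteq> span D"
    using maximal_independent_subset_extend[of B U'] B by blast
  have fin: "finite C" "finite D"
    using independent_span_bound[OF finite_F C(3)] independent_span_bound[OF finite_F D(3)] C D F le
    by blast+
  have spanD: "span D = U'"
    using D sub by (metis span_subspace)
  have spanB: "span B = U \<inter> U'"
    using B sub by (metis span_subspace subspace_inter)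
  have indep: "independent (E \<union> D)" if "finite E" "E \<subseteq> C - B" for E
    using that
  proof (induction E rule: finite_induct)
    case empty
    then show ?case using D by simp
  next
    case (insert x E)
    have "x \<notin> span (E \<union> D)"
    proof
      assume "x \<in> span (E \<union> D)"
      then obtain u w where uw: "x = u + w" "u \<in> span E" "w \<in> span D"
        unfolding span_Un by blast
      have "span E \<subseteq> U"
        using insert.prems C(2) sub(1) by (intro span_minimal) auto
      moreover have "x \<in> U" using insert.prems C(2) by auto
      moreover have "w = x - u" using uw by simp
      ultimately have "w \<in> U"
        using uw(2) sub(1) subspace_diff by blast
      then have "w \<in> span B"
        using uw(3) spanD spanB by simp
      then have "x \<in> span (E \<union> B)"
        unfolding span_Un using uw by blast
      moreover have "E \<union> B \<subseteq> C - {x}"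
        using insert.prems insert.hyps C(1) by auto
      ultimately have "x \<in> span (C - {x})"
        using span_mono by blast
      then show False
        using C(3) insert.prems by (auto simp: dependent_def)
    qed
    then show ?case
      using insert by (simp add: independent_insertI)
  qed
  have "(C - B) \<inter> D = {}"
  proof -
    have False if x: "x \<in> C - B" "x \<in> D" for x
    proof -
      have "x \<in> span B" using x C(2) D(2) spanB by auto
      then have "x \<in> span (C - {x})" using x C(1) span_mono[of B "C - {x}"] by blast
      then show False using C(3) x by (auto simp: dependent_def)
    qed
    then show ?thesis by blast
  qed
  then have "card ((C - B) \<union> D) = card C - card B + card D"
    using fin C(1) by (simp add: card_Un_disjoint card_Diff_subset finite_subset)
  moreover have "card B \<le> card C" using fin C(1) by (simp add: card_mono)
  moreover have "card ((C - B) \<union> D) \<le> dim V"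
  proof -
    have "(C - B) \<union> D \<subseteq> V" using C D le by blast
    then have "dim (span ((C - B) \<union> D)) \<le> dim V"
      using F sub(3) by (intro dim_mono_finite) (auto simp: span_minimal)
    then show ?thesis
      using dim_span_eq_card_independent[OF indep[of "C - B"]] fin by simp
  qed
  moreover have "card C = dim U" "card D = dim U'"
    using C D basis_card_eq_dim by auto
  ultimately show ?thesis using B(4) by linarith
qed

lemma dim_image_le_finite:
  assumes "Vector_Spaces.linear scale scale h" "V \<subseteq> span F"
  shows "dim (h ` V) \<le> dim V"
proof -
  interpret h: Vector_Spaces.linear scale scale h by fact
  obtain B where B: "B \<subseteq> V" "independent B" "V \<subseteq> span B" "card B = dim V"
    by (rule basis_exists)
  have finB: "finite B"
    using independent_span_bound[OF finite_F B(2)] B(1) assms(2) by blast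
  have "h ` V \<subseteq> span (h ` B)"
    using B(3) h.span_image by blast
  then have "dim (h ` V) \<le> card (h ` B)"
    using finB by (intro dim_le_card) auto
  also have "\<dots> \<le> card B" using finB by (rule card_image_le)
  finally show ?thesis using B(4) by simp
qed

section \<open>Eigenvectors modulo a subspace\<close>

text \<open>A section is a pair of subspaces \<open>W \<subseteq> V\<close>. It stands for the quotient \<open>V / W\<close>, which is never
formed: a vector of \<open>V\<close> represents zero if it lies in \<open>W\<close>.\<close>

definition poly_apply :: "('b \<Rightarrow> 'b) \<Rightarrow> 'a poly \<Rightarrow> 'b \<Rightarrow> 'b"
  where "poly_apply T p v = (\<Sum>i\<le>Polynomial.degree p. coeff p i *s (T ^^ i) v)"

lemma poly_apply_altdef:
  fixes p :: "'a poly"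
  assumes "Polynomial.degree p \<le> n"
  shows "poly_apply T p v = (\<Sum>i\<le>n. coeff p i *s (T ^^ i) v)"
  unfolding poly_apply_def using assms
  by (intro sum.mono_neutral_left) (auto simp: coeff_eq_0)

lemma poly_apply_root_factor:
  fixes q :: "'a poly"
  assumes T: "Vector_Spaces.linear scale scale T"
  shows "poly_apply T ([:-\<mu>, 1:] * q) v = T (poly_apply T q v) - \<mu> *s poly_apply T q v"
proof -
  interpret T: Vector_Spaces.linear scale scale T by fact
  let ?n = "Polynomial.degree q"
  have coeff: "coeff ([:-\<mu>, 1:] * q) i = (case i of 0 \<Rightarrow> 0 | Suc j \<Rightarrow> coeff q j) - \<mu> * coeff q i" for i
    by (simp add: coeff_pCons split: nat.split)
  have "Polynomial.degree ([:-\<mu>, 1:] * q) \<le> Suc ?n"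
    using degree_mult_le[of "[:-\<mu>, 1:]" q] by simp
  then have "poly_apply T ([:-\<mu>, 1:] * q) v
      = (\<Sum>i\<le>Suc ?n. (case i of 0 \<Rightarrow> 0 | Suc j \<Rightarrow> coeff q j) *s (T ^^ i) v)
        - (\<Sum>i\<le>Suc ?n. (\<mu> * coeff q i) *s (T ^^ i) v)"
    unfolding poly_apply_altdef[OF \<open>_ \<le> Suc ?n\<close>] coeff
    by (simp only: scale_left_diff_distrib sum_subtractf)
  also have "(\<Sum>i\<le>Suc ?n. (case i of 0 \<Rightarrow> 0 | Suc j \<Rightarrow> coeff q j) *s (T ^^ i) v) = T (poly_apply T q v)"
    by (subst sum.atMost_Suc_shift) (simp add: poly_apply_def T.sum T.scale)
  also have "(\<Sum>i\<le>Suc ?n. (\<mu> * coeff q i) *s (T ^^ i) v) = \<mu> *s poly_apply T q v"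
    by (subst poly_apply_altdef[of q "Suc ?n"]) (simp_all only: scale_sum_right scale_scale le_SucI)
  finally show ?thesis .
qed

lemma poly_apply_mem:
  assumes "subspace V" "v \<in> V" "\<And>x. x \<in> V \<Longrightarrow> T x \<in> V"
  shows "poly_apply T p v \<in> V"
proof -
  have "(T ^^ i) v \<in> V" for i
    by (induction i) (use assms in auto)
  then show ?thesis
    unfolding poly_apply_def using assms(1) by (intro subspace_sum subspace_scale)
qed

text \<open>The \<open>card F + 1\<close> vectors \<open>v, T v, T\<^sup>2 v, \<dots>\<close> in the span of \<open>F\<close> are linearly dependent.\<close>

lemma annihilating_poly_exists:
  assumes F: "V \<subseteq> span F" and T: "\<And>x. x \<in> V \<Longrightarrow> T x \<in> V" and v: "v \<in> V"
  shows "\<exists>p :: 'a poly. p \<noteq> 0 \<and> poly_apply T p v = 0"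
proof -
  have "(T ^^ i) v \<in> V" for i
    by (induction i) (use T v in auto)
  then have "\<exists>r. (T ^^ i) v = (\<Sum>b\<in>F. r b *s b)" for i
    using F by (auto simp: span_finite finite_F)
  then obtain r where r: "\<And>i. (T ^^ i) v = (\<Sum>b\<in>F. r i b *s b)"
    by metis
  obtain c where c: "\<exists>i\<in>{..card F}. c i \<noteq> 0"
      "\<And>b. b \<in> F \<Longrightarrow> (\<Sum>i\<le>card F. r i b * c i) = 0"
    using homogeneous_system_nontrivial_solution[of F "{..card F}" "\<lambda>b i. r i b"] finite_F by auto
  define p where "p = (\<Sum>i\<le>card F. monom (c i) i)"
  have coeff_p: "coeff p i = (if i \<le> card F then c i else 0)" for i
    by (auto simp: p_def coeff_sum if_distrib cong: if_cong)
  have "Polynomial.degree p \<le> card F"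
    by (rule degree_le) (simp add: coeff_p)
  then have "poly_apply T p v = (\<Sum>i\<le>card F. c i *s (T ^^ i) v)"
    by (subst poly_apply_altdef[of p "card F"]) (auto simp: coeff_p intro: sum.cong)
  also have "\<dots> = (\<Sum>i\<le>card F. \<Sum>b\<in>F. (r i b * c i) *s b)"
    unfolding r by (simp add: scale_sum_right mult.commute)
  also have "\<dots> = (\<Sum>b\<in>F. (\<Sum>i\<le>card F. r i b * c i) *s b)"
    by (subst sum.swap) (simp add: scale_sum_left)
  also have "\<dots> = 0" using c(2) by simp
  finally show ?thesis
    using c(1) coeff_p by (intro exI[of _ p]) (auto simp: poly_eq_iff)
qed

text \<open>Take a nonzero polynomial \<open>p\<close> of least degree that maps \<open>v \<notin> W\<close> into \<open>W\<close>. It is not constant, so it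
factors as \<open>(X - \<mu>) q\<close>, and by minimality \<open>q\<close> maps \<open>v\<close> to an eigenvector of the section.\<close>

lemma section_eigenvector_exists:
  assumes closed: "\<And>p :: 'a poly. Polynomial.degree p > 0 \<Longrightarrow> \<exists>x. poly p x = 0"
    and F: "V \<subseteq> span F" and sub: "subspace W" "subspace V" "W \<subset> V"
    and T: "Vector_Spaces.linear scale scale T" "\<And>x. x \<in> V \<Longrightarrow> T x \<in> V"
  shows "\<exists>\<mu>. \<exists>v\<in>V - W. T v - \<mu> *s v \<in> W"
proof -
  obtain v where v: "v \<in> V" "v \<notin> W" using sub by blast
  define A where "A p \<longleftrightarrow> p \<noteq> 0 \<and> poly_apply T p v \<in> W" for p :: "'a poly"
  obtain p0 :: "'a poly" where "p0 \<noteq> 0" "poly_apply T p0 v = 0"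
    using annihilating_poly_exists[where T = T, OF F T(2) v(1)] by blast
  then have "\<exists>p. A p"
    using subspace_0[OF sub(1)] by (auto simp: A_def)
  then obtain p where p: "A p" and min: "\<And>q. A q \<Longrightarrow> Polynomial.degree p \<le> Polynomial.degree q"
    using ex_has_least_nat[of A _ Polynomial.degree] by blast
  have "Polynomial.degree p > 0"
  proof (rule ccontr)
    assume "\<not> ?thesis"
    then have deg: "Polynomial.degree p = 0" by simp
    then have "coeff p 0 *s v \<in> W" "coeff p 0 \<noteq> 0"
      using p by (auto simp: A_def poly_apply_def leading_coeff_0_iff[symmetric] simp del: leading_coeff_0_iff)
    then have "inverse (coeff p 0) *s (coeff p 0 *s v) \<in> W"
      using sub(1) subspace_scale by blast
    then show False using v \<open>coeff p 0 \<noteq> 0\<close> by simp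
  qed
  then obtain \<mu> where "poly p \<mu> = 0" using closed by blast
  then obtain q where q: "p = [:-\<mu>, 1:] * q" by (auto simp: poly_eq_0_iff_dvd)
  have "q \<noteq> 0" using p q by (auto simp: A_def)
  then have "Polynomial.degree p = Suc (Polynomial.degree q)"
    unfolding q by (subst degree_mult_eq) auto
  then have "\<not> A q" using min[of q] by auto
  then have "poly_apply T q v \<notin> W" using \<open>q \<noteq> 0\<close> by (simp add: A_def)
  moreover have "poly_apply T q v \<in> V"
    using sub v T by (intro poly_apply_mem) auto
  moreover have "T (poly_apply T q v) - \<mu> *s poly_apply T q v \<in> W"
    using p unfolding A_def q poly_apply_root_factor[OF T(1)] by blast
  ultimately show ?thesis by blast
qed

end

section \<open>Irreducible sections of commuting operator groups\<close>

locale commuting_operator_groups = ambient_space scale F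
  for scale :: "'a::alg_closed_field \<Rightarrow> 'b::ab_group_add \<Rightarrow> 'b" (infixr "*s" 75) and F +
  fixes I :: "'i set" and T :: "'i \<Rightarrow> ('b \<Rightarrow> 'b) set"
  assumes linear_T: "\<And>i g. i \<in> I \<Longrightarrow> g \<in> T i \<Longrightarrow> Vector_Spaces.linear scale scale g"
    and comp_T: "\<And>i g h. i \<in> I \<Longrightarrow> g \<in> T i \<Longrightarrow> h \<in> T i \<Longrightarrow> g \<circ> h \<in> T i"
    and inverse_T: "\<And>i g. i \<in> I \<Longrightarrow> g \<in> T i \<Longrightarrow>
      \<exists>h\<in>T i. \<forall>x\<in>span F. h (g x) = x \<and> g (h x) = x"
    and commute_T: "\<And>i j g h x. i \<in> I \<Longrightarrow> j \<in> I \<Longrightarrow> i \<noteq> j \<Longrightarrow> g \<in> T i \<Longrightarrow> h \<in> T j \<Longrightarrow>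
      g (h x) = h (g x)"
begin

text \<open>The index set \<open>S\<close> says which of the operator groups act; restricting
it passes to the subgroup generated by some of the factors.\<close>

definition stable :: "'i set \<Rightarrow> 'b set \<Rightarrow> bool"
  where "stable S U \<longleftrightarrow> (\<forall>i\<in>S. \<forall>g\<in>T i. \<forall>u\<in>U. g u \<in> U)"

definition irreducible_section :: "'i set \<Rightarrow> 'b set \<Rightarrow> 'b set \<Rightarrow> bool"
  where "irreducible_section S W V \<longleftrightarrow>
    W \<subset> V \<and> (\<forall>U. subspace U \<longrightarrow> W \<subseteq> U \<longrightarrow> U \<subseteq> V \<longrightarrow> stable S U \<longrightarrow> U = W \<or> U = V)"

definition commutative_section :: "'i \<Rightarrow> 'b set \<Rightarrow> 'b set \<Rightarrow> bool"
  where "commutative_section i W V \<longleftrightarrow> (\<forall>g\<in>T i. \<forall>h\<in>T i. \<forall>v\<in>V. g (h v) - h (g v) \<in> W)"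

text \<open>Schur's lemma: the eigenspace of \<open>g\<close> in the section is stable under the operators with index in \<open>S\<close>,
since these commute with \<open>g\<close>.\<close>

lemma operator_of_other_index_is_scalar:
  assumes sub: "subspace W" "subspace V" "V \<subseteq> span F" and stab: "stable (insert i S) W" "stable (insert i S) V"
    and irr: "irreducible_section S W V" and S: "insert i S \<subseteq> I" "i \<notin> S" and g: "g \<in> T i"
  shows "\<exists>\<mu>. \<forall>v\<in>V. g v - \<mu> *s v \<in> W"
proof -
  interpret g: Vector_Spaces.linear scale scale g
    using linear_T g S by blast
  have WV: "W \<subset> V" using irr by (simp add: irreducible_section_def)
  obtain \<mu> v where v: "v \<in> V" "v \<notin> W" "g v - \<mu> *s v \<in> W"
    using section_eigenvector_exists[OF alg_closed_imp_poly_has_root sub(3,1,2) WV, of g]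
      g.linear_axioms stab(2) g by (auto simp: stable_def)
  define U where "U = {v \<in> V. g v - \<mu> *s v \<in> W}"
  have gW: "g w - \<mu> *s w \<in> W" if "w \<in> W" for w
    using that stab(1) g sub(1) by (auto simp: stable_def intro!: subspace_diff subspace_scale)
  have "subspace U"
    unfolding subspace_def
  proof (intro conjI ballI allI)
    show "0 \<in> U" using sub by (simp add: U_def subspace_0)
  next
    fix x y assume "x \<in> U" "y \<in> U"
    then show "x + y \<in> U"
      using sub subspace_add[of W "g x - \<mu> *s x" "g y - \<mu> *s y"]
      by (auto simp: U_def g.add scale_right_distrib subspace_add algebra_simps)
  next
    fix c x assume "x \<in> U"
    then show "c *s x \<in> U"
      using sub subspace_scale[of W "g x - \<mu> *s x" c]
      by (auto simp: U_def g.scale scale_right_diff_distrib subspace_scale mult.commute)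
  qed
  moreover have "W \<subseteq> U" using gW WV by (auto simp: U_def)
  moreover have "U \<subseteq> V" by (auto simp: U_def)
  moreover have "stable S U"
    unfolding stable_def
  proof (intro ballI)
    fix j h u assume j: "j \<in> S" and h: "h \<in> T j" and u: "u \<in> U"
    interpret h: Vector_Spaces.linear scale scale h
      using linear_T h j S by blast
    have "i \<noteq> j" using j S by auto
    then have "g (h u) - \<mu> *s h u = h (g u - \<mu> *s u)"
      using commute_T[of i j g h u] g h j S by (auto simp: h.diff h.scale)
    also have "\<dots> \<in> W" using u j h stab(1) by (auto simp: U_def stable_def)
    finally show "h u \<in> U" using u j h stab(2) by (auto simp: U_def stable_def)
  qed
  ultimately have "U = W \<or> U = V"
    using irr by (auto simp: irreducible_section_def)
  then have "U = V" using v by (auto simp: U_def)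
  then show ?thesis by (auto simp: U_def)
qed

text \<open>Operators that are scalar modulo \<open>W\<close> commute modulo \<open>W\<close>.\<close>

lemma commutative_section_if_others_irreducible:
  assumes sub: "subspace W" "subspace V" "V \<subseteq> span F" and stab: "stable (insert i S) W" "stable (insert i S) V"
    and irr: "irreducible_section S W V" and S: "insert i S \<subseteq> I" "i \<notin> S"
  shows "commutative_section i W V"
  unfolding commutative_section_def
proof (intro ballI)
  fix g h v assume g: "g \<in> T i" and h: "h \<in> T i" and v: "v \<in> V"
  interpret g: Vector_Spaces.linear scale scale g using linear_T g S by blast
  interpret h: Vector_Spaces.linear scale scale h using linear_T h S by blast
  obtain \<mu> \<nu> where \<mu>: "\<And>v. v \<in> V \<Longrightarrow> g v - \<mu> *s v \<in> W" and \<nu>: "\<And>v. v \<in> V \<Longrightarrow> h v - \<nu> *s v \<in> W"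
    using operator_of_other_index_is_scalar[OF assms] g h by metis
  have "h v \<in> V" "g v \<in> V" using stab(2) g h v by (auto simp: stable_def)
  then have "g (h v) - \<mu> *s h v \<in> W" "h v - \<nu> *s v \<in> W"
    "h (g v) - \<nu> *s g v \<in> W" "g v - \<mu> *s v \<in> W"
    using \<mu> \<nu> v by blast+
  then have "(g (h v) - \<mu> *s h v) + \<mu> *s (h v - \<nu> *s v)
      - ((h (g v) - \<nu> *s g v) + \<nu> *s (g v - \<mu> *s v)) \<in> W"
    using sub(1) by (meson subspace_diff subspace_add subspace_scale)
  then show "g (h v) - h (g v) \<in> W"
    by (simp add: scale_right_diff_distrib mult.commute)
qed

lemma translate_subspace:
  assumes "i \<in> I" "g \<in> T i" "subspace U"
  shows "subspace (g ` U)"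
proof -
  interpret g: Vector_Spaces.linear scale scale g using linear_T assms by blast
  show ?thesis using assms(3) by (rule g.subspace_image)
qed

text \<open>Induction on \<open>S\<close>. When an index \<open>i\<close> is added, choose a section \<open>(W, U)\<close> of \<open>(W, V)\<close> that is minimal
among those stable under the other indices, hence irreducible for them. Its translates \<open>g U\<close> by
operators \<open>g \<in> T i\<close> are isomorphic to it and together span \<open>V\<close>, by irreducibility. Hence
a group with index in \<open>S\<close> that acts commutatively on \<open>(W, U)\<close> acts commutatively on \<open>(W, V)\<close>, so the induction
hypothesis applies to \<open>(W, U)\<close>. By Schur's lemma \<open>U \<noteq> V\<close>, as \<open>T i\<close> is not commutative, so
some translate \<open>g U\<close> differs from \<open>U\<close>. By minimality \<open>U \<inter> g U = W\<close>, and the relative dimension at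
least doubles.\<close>

lemma dim_irreducible_noncommutative:
  assumes "finite S" "S \<subseteq> I" "subspace W" "subspace V" "V \<subseteq> span F"
    and "stable S W" "stable S V" "irreducible_section S W V"
    and "\<And>i. i \<in> S \<Longrightarrow> \<not> commutative_section i W V"
  shows "dim W + 2 ^ card S \<le> dim V"
  using assms
proof (induction S arbitrary: V rule: finite_induct)
  case empty
  then show ?case
    using dim_strict_mono[of V W] by (auto simp: irreducible_section_def)
next
  case (insert i S)
  note sub = \<open>subspace W\<close> \<open>subspace V\<close> \<open>V \<subseteq> span F\<close>
  note stab = \<open>stable (insert i S) W\<close> \<open>stable (insert i S) V\<close>
  have iI: "i \<in> I" and SI: "S \<subseteq> I" using insert.prems by auto
  have WV: "W \<subset> V" using insert.prems by (simp add: irreducible_section_def)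
  define A where "A U \<longleftrightarrow> subspace U \<and> W \<subset> U \<and> U \<subseteq> V \<and> stable S U" for U
  have "A V" using sub WV stab by (auto simp: A_def stable_def)
  then obtain U where U: "A U" and min: "\<And>U'. A U' \<Longrightarrow> dim U \<le> dim U'"
    using ex_has_least_nat[of A _ dim] by blast
  have UV: "subspace U" "W \<subset> U" "U \<subseteq> V" "stable S U" "U \<subseteq> span F"
    using U sub by (auto simp: A_def)
  have minU: "U' = W \<or> U' = U" if "subspace U'" "W \<subseteq> U'" "U' \<subseteq> U" "stable S U'" for U'
  proof (rule ccontr)
    assume "\<not> ?thesis"
    then have "A U'" "U' \<subset> U" using that UV by (auto simp: A_def)
    then have "dim U' < dim U" using that UV by (intro dim_strict_mono)
    then show False using min[OF \<open>A U'\<close>] by simp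
  qed
  have irrU: "irreducible_section S W U"
    using UV minU by (auto simp: irreducible_section_def)
  have T_V: "g v \<in> V" if "g \<in> T i" "v \<in> V" for g v
    using stab(2) that by (auto simp: stable_def)
  have translate: "subspace (g ` U)" "W \<subseteq> g ` U" "g ` U \<subseteq> V" "stable S (g ` U)" "dim U \<le> dim (g ` U)"
    if g: "g \<in> T i" for g
  proof -
    obtain h where h: "h \<in> T i" "\<And>x. x \<in> span F \<Longrightarrow> h (g x) = x" "\<And>x. x \<in> span F \<Longrightarrow> g (h x) = x"
      using inverse_T[OF iI g] by blast
    show "subspace (g ` U)" using translate_subspace[OF iI g UV(1)] .
    show "g ` U \<subseteq> V" using T_V[OF g] UV by blast
    show "W \<subseteq> g ` U"
    proof
      fix w assume w: "w \<in> W"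
      then have "w \<in> span F" "h w \<in> W" using h(1) stab(1) UV by (auto simp: stable_def)
      then have "w = g (h w)" "h w \<in> U" using h(3) UV by auto
      then show "w \<in> g ` U" by blast
    qed
    show "stable S (g ` U)"
      unfolding stable_def
    proof (intro ballI, elim imageE, hypsubst)
      fix j k u assume j: "j \<in> S" and k: "k \<in> T j" and u: "u \<in> U"
      have "k (g u) = g (k u)"
        using commute_T[of j i k g u] j k g iI SI insert.hyps by auto
      then show "k (g u) \<in> g ` U" using UV(4) j k u by (auto simp: stable_def)
    qed
    have "h ` g ` U = U" using h(2) UV(5) by force
    then show "dim U \<le> dim (g ` U)"
      using dim_image_le_finite[OF linear_T[OF iI h(1)], of "g ` U"] \<open>g ` U \<subseteq> V\<close> sub by auto
  qed
  \<comment> \<open>The span of all translates; it turns out to be \<open>V\<close>.\<close>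
  define Y where "Y = span (\<Union>g\<in>T i. g ` U)"
  have "Y = V"
  proof -
    obtain g where g: "g \<in> T i"
      using insert.prems(8)[of i] by (auto simp: commutative_section_def)
    obtain h where h: "h \<in> T i" "\<And>x. x \<in> span F \<Longrightarrow> h (g x) = x"
      using inverse_T[OF iI g] by blast
    have "U \<subseteq> Y"
    proof
      fix u assume u: "u \<in> U"
      \<comment> \<open>\<open>h \<circ> g\<close> acts as the identity, so \<open>U\<close> is itself one of the translates.\<close>
      have "u = (h \<circ> g) u" "h \<circ> g \<in> T i" using h u UV(5) comp_T[OF iI h(1) g] by auto
      then show "u \<in> Y" unfolding Y_def using u by (intro span_base) blast
    qed
    moreover have "Y \<subseteq> V"
      unfolding Y_def using translate(3) sub by (intro span_minimal) auto
    moreover have "stable (insert i S) Y"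
      unfolding stable_def
    proof (intro ballI)
      fix j k y assume j: "j \<in> insert i S" and k: "k \<in> T j" and y: "y \<in> Y"
      interpret k: Vector_Spaces.linear scale scale k
        using linear_T j k iI SI by blast
      have "k ` (\<Union>g\<in>T i. g ` U) \<subseteq> (\<Union>g\<in>T i. g ` U)"
      proof (cases "j = i")
        case True
        then have "k \<circ> g \<in> T i" if "g \<in> T i" for g
          using k that comp_T[OF iI] by blast
        then show ?thesis by fastforce
      next
        case False
        then show ?thesis using k j translate(4) by (fastforce simp: stable_def)
      qed
      then show "k y \<in> Y"
        using y unfolding Y_def by (metis image_eqI k.span_image span_mono subsetD)
    qed
    moreover have "subspace Y" by (simp add: Y_def)
    ultimately show ?thesis
      using insert.prems(7) UV(2) unfolding irreducible_section_def by (metis psubset_eq subset_trans subset_antisym)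
  qed
  have "U \<noteq> V"
  proof
    assume "U = V"
    then have "commutative_section i W V"
      using commutative_section_if_others_irreducible[OF sub stab] irrU iI SI insert.hyps by simp
    then show False using insert.prems(8) by blast
  qed
  have "\<exists>g\<in>T i. \<not> g ` U \<subseteq> U"
  proof (rule ccontr)
    assume "\<not> ?thesis"
    then have "Y \<subseteq> U" unfolding Y_def using UV(1) by (intro span_minimal) auto
    then show False using \<open>Y = V\<close> \<open>U \<noteq> V\<close> UV(3) by blast
  qed
  then obtain g where g: "g \<in> T i" "\<not> g ` U \<subseteq> U" by blast
  have "U \<inter> g ` U = W"
  proof (rule ccontr)
    assume ne: "U \<inter> g ` U \<noteq> W"
    have "stable S (U \<inter> g ` U)"
      using UV(4) translate(4)[OF g(1)] unfolding stable_def by blast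
    then have "U \<inter> g ` U = U"
      using minU[of "U \<inter> g ` U"] subspace_inter[OF UV(1) translate(1)[OF g(1)]]
        translate(2)[OF g(1)] UV(2) ne by blast
    then have "U \<subset> g ` U" using g(2) by blast
    moreover have "dim (g ` U) \<le> dim U"
      using dim_image_le_finite[OF linear_T[OF iI g(1)] UV(5)] .
    moreover have "g ` U \<subseteq> span F" using translate(3)[OF g(1)] sub(3) by blast
    ultimately show False using dim_strict_mono[of "g ` U" U] UV(1) by simp
  qed
  then have "dim U + dim (g ` U) \<le> dim V + dim W"
    using dim_add_le[OF sub(3) UV(1) translate(1)[OF g(1)] sub(2) UV(3) translate(3)[OF g(1)]] by simp
  then have "2 * dim U \<le> dim V + dim W"
    using translate(5)[OF g(1)] by simp
  moreover have "dim W + 2 ^ card S \<le> dim U"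
  proof (rule insert.IH[OF SI sub(1) UV(1,5) _ UV(4) irrU])
    show "stable S W" using stab by (auto simp: stable_def)
    fix j assume j: "j \<in> S"
    show "\<not> commutative_section j W U"
    proof
      assume comm: "commutative_section j W U"
      have "x (y v) - y (x v) \<in> W" if xy: "x \<in> T j" "y \<in> T j" and v: "v \<in> V" for x y v
      proof -
        have jI: "j \<in> I" "j \<noteq> i" using j SI insert.hyps by auto
        interpret x: Vector_Spaces.linear scale scale x using linear_T xy jI by blast
        interpret y: Vector_Spaces.linear scale scale y using linear_T xy jI by blast
        have "v \<in> span (\<Union>g\<in>T i. g ` U)" using v \<open>Y = V\<close> by (simp add: Y_def)
        then show ?thesis
        proof (induction rule: span_induct_alt)
          case base
          then show ?case using sub by (simp add: subspace_0)
        next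
          case (step c z v)
          then obtain g u where z: "z = g u" "g \<in> T i" "u \<in> U" by blast
          interpret g: Vector_Spaces.linear scale scale g using linear_T z iI by blast
          \<comment> \<open>The commutator of \<open>x\<close> and \<open>y\<close> commutes with \<open>g\<close>, and \<open>W\<close> is stable under \<open>g\<close>.\<close>
          have "x (y z) - y (x z) = g (x (y u) - y (x u))"
            using commute_T[OF jI(1) iI jI(2) _ z(2)] xy by (simp add: z g.diff)
          also have "\<dots> \<in> W"
            using comm xy z stab(1) by (auto simp: commutative_section_def stable_def)
          finally have "c *s (x (y z) - y (x z)) + (x (y v) - y (x v)) \<in> W"
            using step sub(1) by (intro subspace_add subspace_scale)
          then show ?case
            by (simp add: x.add y.add x.scale y.scale scale_right_diff_distrib algebra_simps)
        qed
      qed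
      then have "commutative_section j W V" by (simp add: commutative_section_def)
      then show False using insert.prems(8) j by blast
    qed
  qed
  ultimately show ?case
    using insert.hyps by simp
qed

end

section \<open>Sections on which a group acts solvably\<close>

locale commuting_group_actions = ambient_space scale F
  for scale :: "'a::alg_closed_field \<Rightarrow> 'b::ab_group_add \<Rightarrow> 'b" (infixr "*s" 75) and F +
  fixes I :: "'i set" and G :: "'i \<Rightarrow> ('g, 'h) monoid_scheme" and \<rho> :: "'i \<Rightarrow> 'g \<Rightarrow> 'b \<Rightarrow> 'b"
  assumes group_G: "\<And>i. i \<in> I \<Longrightarrow> group (G i)"
    and linear_\<rho>: "\<And>i x. i \<in> I \<Longrightarrow> x \<in> carrier (G i) \<Longrightarrow> Vector_Spaces.linear scale scale (\<rho> i x)"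
    and \<rho>_mult: "\<And>i x y v. i \<in> I \<Longrightarrow> x \<in> carrier (G i) \<Longrightarrow> y \<in> carrier (G i) \<Longrightarrow>
      \<rho> i (x \<otimes>\<^bsub>G i\<^esub> y) v = \<rho> i x (\<rho> i y v)"
    and \<rho>_one: "\<And>i v. i \<in> I \<Longrightarrow> v \<in> span F \<Longrightarrow> \<rho> i \<one>\<^bsub>G i\<^esub> v = v"
    and \<rho>_commute: "\<And>i j x y v. i \<in> I \<Longrightarrow> j \<in> I \<Longrightarrow> i \<noteq> j \<Longrightarrow>
      x \<in> carrier (G i) \<Longrightarrow> y \<in> carrier (G j) \<Longrightarrow> \<rho> i x (\<rho> j y v) = \<rho> j y (\<rho> i x v)"
begin

sublocale commuting_operator_groups scale F I "\<lambda>i. \<rho> i ` carrier (G i)"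
proof (intro commuting_operator_groups.intro ambient_space_axioms commuting_operator_groups_axioms.intro)
  fix i g assume i: "i \<in> I" and g: "g \<in> \<rho> i ` carrier (G i)"
  interpret G: group "G i" using group_G i .
  show "Vector_Spaces.linear scale scale g" using linear_\<rho> i g by blast
  obtain x where x: "x \<in> carrier (G i)" "g = \<rho> i x" using g by blast
  have "\<rho> i (inv\<^bsub>G i\<^esub> x) (g v) = v \<and> g (\<rho> i (inv\<^bsub>G i\<^esub> x) v) = v" if "v \<in> span F" for v
    using \<rho>_mult[OF i _ x(1), symmetric] \<rho>_mult[OF i x(1), symmetric] \<rho>_one[OF i that] x by simp
  then show "\<exists>h\<in>\<rho> i ` carrier (G i). \<forall>x\<in>span F. h (g x) = x \<and> g (h x) = x"
    using x by (intro bexI[of _ "\<rho> i (inv\<^bsub>G i\<^esub> x)"]) auto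
next
  fix i g h assume i: "i \<in> I" and gh: "g \<in> \<rho> i ` carrier (G i)" "h \<in> \<rho> i ` carrier (G i)"
  interpret G: group "G i" using group_G i .
  obtain x y where xy: "x \<in> carrier (G i)" "g = \<rho> i x" "y \<in> carrier (G i)" "h = \<rho> i y"
    using gh by blast
  have "g \<circ> h = \<rho> i (x \<otimes>\<^bsub>G i\<^esub> y)"
    using xy \<rho>_mult[OF i] by auto
  then show "g \<circ> h \<in> \<rho> i ` carrier (G i)"
    using xy by blast
next
  fix i j g h x
  assume "i \<in> I" "j \<in> I" "i \<noteq> j" "g \<in> \<rho> i ` carrier (G i)" "h \<in> \<rho> j ` carrier (G j)"
  then show "g (h x) = h (g x)" using \<rho>_commute by blast
qed

definition section_kernel :: "'i \<Rightarrow> 'b set \<Rightarrow> 'b set \<Rightarrow> 'g set"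
  where "section_kernel i W V = {x \<in> carrier (G i). \<forall>v\<in>V. \<rho> i x v - v \<in> W}"

text \<open>Since \<open>section_kernel\<close> is the kernel of the action on \<open>V / W\<close>, this says that the image of the group
in the automorphisms of \<open>V / W\<close> is solvable.\<close>

definition solvable_section :: "'i \<Rightarrow> 'b set \<Rightarrow> 'b set \<Rightarrow> bool"
  where "solvable_section i W V \<longleftrightarrow>
    (\<exists>m. (derived (G i) ^^ m) (carrier (G i)) \<subseteq> section_kernel i W V)"

lemma \<rho>_stable: "stable S V \<Longrightarrow> i \<in> S \<Longrightarrow> x \<in> carrier (G i) \<Longrightarrow> v \<in> V \<Longrightarrow> \<rho> i x v \<in> V"
  by (auto simp: stable_def)

lemma section_kernel_subgroup:
  assumes i: "i \<in> I" and W: "subspace W" and V: "V \<subseteq> span F" "stable {i} V"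
  shows "subgroup (section_kernel i W V) (G i)"
proof -
  interpret G: group "G i" using group_G i .
  note V_mem = \<rho>_stable[OF V(2), of i, simplified]
  show ?thesis
  proof (rule G.subgroupI)
    show "section_kernel i W V \<subseteq> carrier (G i)" by (auto simp: section_kernel_def)
    have "\<one>\<^bsub>G i\<^esub> \<in> section_kernel i W V"
      using \<rho>_one[OF i] V subspace_0[OF W] by (auto simp: section_kernel_def)
    then show "section_kernel i W V \<noteq> {}" by blast
  next
    fix x assume x: "x \<in> section_kernel i W V"
    then have xc: "x \<in> carrier (G i)" by (simp add: section_kernel_def)
    have "\<rho> i (inv\<^bsub>G i\<^esub> x) v - v \<in> W" if v: "v \<in> V" for v
    proof -
      let ?u = "\<rho> i (inv\<^bsub>G i\<^esub> x) v"
      have "\<rho> i x ?u = v"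
        using \<rho>_mult[OF i xc, of "inv\<^bsub>G i\<^esub> x" v] \<rho>_one[OF i, of v] xc v V by auto
      moreover have "\<rho> i x ?u - ?u \<in> W"
        using x V_mem[of "inv\<^bsub>G i\<^esub> x" v] xc v by (auto simp: section_kernel_def)
      ultimately show ?thesis using subspace_neg[OF W, of "v - ?u"] by simp
    qed
    then show "inv\<^bsub>G i\<^esub> x \<in> section_kernel i W V" using xc by (simp add: section_kernel_def)
  next
    fix x y assume xy: "x \<in> section_kernel i W V" "y \<in> section_kernel i W V"
    then have c: "x \<in> carrier (G i)" "y \<in> carrier (G i)" by (auto simp: section_kernel_def)
    have "\<rho> i (x \<otimes>\<^bsub>G i\<^esub> y) v - v \<in> W" if v: "v \<in> V" for v
    proof -
      have "(\<rho> i x (\<rho> i y v) - \<rho> i y v) + (\<rho> i y v - v) \<in> W"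
        using xy v V_mem[OF c(2) v] by (intro subspace_add[OF W]) (auto simp: section_kernel_def)
      then show ?thesis by (simp add: \<rho>_mult[OF i c])
    qed
    then show "x \<otimes>\<^bsub>G i\<^esub> y \<in> section_kernel i W V" using c by (simp add: section_kernel_def)
  qed
qed

text \<open>If \<open>x\<close> and \<open>y\<close> commute on \<open>V\<close> modulo \<open>W\<close>, then applying this to \<open>u = x\<^sup>-\<^sup>1 y\<^sup>-\<^sup>1 v\<close> shows that their
commutator moves \<open>v\<close> by an element of \<open>W\<close>.\<close>

lemma derived_subset_section_kernel:
  assumes i: "i \<in> I" and W: "subspace W" and V: "V \<subseteq> span F" "stable {i} V"
    and D: "D \<subseteq> carrier (G i)"
    and comm: "\<And>x y v. x \<in> D \<Longrightarrow> y \<in> D \<Longrightarrow> v \<in> V \<Longrightarrow> \<rho> i x (\<rho> i y v) - \<rho> i y (\<rho> i x v) \<in> W"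
  shows "derived (G i) D \<subseteq> section_kernel i W V"
proof -
  interpret G: group "G i" using group_G i .
  have "x \<otimes>\<^bsub>G i\<^esub> y \<otimes>\<^bsub>G i\<^esub> inv\<^bsub>G i\<^esub> x \<otimes>\<^bsub>G i\<^esub> inv\<^bsub>G i\<^esub> y \<in> section_kernel i W V"
    if xy: "x \<in> D" "y \<in> D" for x y
  proof -
    have c: "x \<in> carrier (G i)" "y \<in> carrier (G i)" using xy D by auto
    have "\<rho> i (x \<otimes>\<^bsub>G i\<^esub> y \<otimes>\<^bsub>G i\<^esub> inv\<^bsub>G i\<^esub> x \<otimes>\<^bsub>G i\<^esub> inv\<^bsub>G i\<^esub> y) v - v \<in> W" if v: "v \<in> V" for v
    proof -
      define u where "u = \<rho> i (inv\<^bsub>G i\<^esub> x) (\<rho> i (inv\<^bsub>G i\<^esub> y) v)"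
      have "u \<in> V"
        using \<rho>_stable[OF V(2), of i] v c by (auto simp: u_def)
      have cancel: "\<rho> i z (\<rho> i (inv\<^bsub>G i\<^esub> z) w) = w" if "z \<in> carrier (G i)" "w \<in> V" for z w
        using \<rho>_mult[OF i that(1), of "inv\<^bsub>G i\<^esub> z" w] \<rho>_one[OF i, of w] that V by auto
      have "\<rho> i (inv\<^bsub>G i\<^esub> y) v \<in> V"
        using \<rho>_stable[OF V(2), of i] v c by auto
      then have "\<rho> i y (\<rho> i x u) = v"
        using cancel c v by (simp add: u_def)
      moreover have "\<rho> i (x \<otimes>\<^bsub>G i\<^esub> y \<otimes>\<^bsub>G i\<^esub> inv\<^bsub>G i\<^esub> x \<otimes>\<^bsub>G i\<^esub> inv\<^bsub>G i\<^esub> y) v = \<rho> i x (\<rho> i y u)"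
        using c by (simp add: \<rho>_mult[OF i] u_def)
      ultimately show ?thesis using comm[OF xy \<open>u \<in> V\<close>] by simp
    qed
    then show ?thesis using c by (simp add: section_kernel_def)
  qed
  then have "derived_set (G i) D \<subseteq> section_kernel i W V" by auto
  then show ?thesis
    unfolding derived_def
    using G.generate_subgroup_incl section_kernel_subgroup[OF i W V] by blast
qed

lemma commutative_imp_solvable_section:
  assumes "i \<in> I" "subspace W" "V \<subseteq> span F" "stable {i} V" "commutative_section i W V"
  shows "solvable_section i W V"
  unfolding solvable_section_def
  using derived_subset_section_kernel[OF assms(1-4), of "carrier (G i)"] assms(5)
  by (intro exI[of _ 1]) (auto simp: commutative_section_def)

text \<open>Deep in the derived series, elements act as \<open>1 + \<alpha>\<close>, where \<open>\<alpha>\<close> maps \<open>V\<close> to \<open>U\<close> and \<open>U\<close> to \<open>W\<close>.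
The product of two such \<open>\<alpha>\<close> maps \<open>V\<close> to \<open>W\<close>, so these elements commute modulo \<open>W\<close> and one more
derived subgroup acts trivially.\<close>

lemma solvable_section_extension:
  assumes i: "i \<in> I" and sub: "subspace W" "subspace U" and V: "V \<subseteq> span F" "stable {i} V"
    and lower: "solvable_section i W U" and upper: "solvable_section i U V"
  shows "solvable_section i W V"
proof -
  interpret G: group "G i" using group_G i .
  obtain m where m: "(derived (G i) ^^ m) (carrier (G i)) \<subseteq> section_kernel i W U"
    using lower by (auto simp: solvable_section_def)
  obtain n where n: "(derived (G i) ^^ n) (carrier (G i)) \<subseteq> section_kernel i U V"
    using upper by (auto simp: solvable_section_def)
  define D where "D = (derived (G i) ^^ (m + n)) (carrier (G i))"
  have le: "(derived (G i) ^^ (k + l)) (carrier (G i)) \<subseteq> (derived (G i) ^^ k) (carrier (G i))" for k l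
    unfolding funpow_add comp_def
    by (intro G.mono_exp_of_derived G.exp_of_derived_in_carrier order_refl)
  have D: "D \<subseteq> section_kernel i W U" "D \<subseteq> section_kernel i U V"
    using le[of m n] le[of n m] m n by (auto simp: D_def add.commute)
  have Dc: "D \<subseteq> carrier (G i)" using D by (auto simp: section_kernel_def)
  have "\<rho> i x (\<rho> i y v) - \<rho> i y (\<rho> i x v) \<in> W" if xy: "x \<in> D" "y \<in> D" and v: "v \<in> V" for x y v
  proof -
    interpret x: Vector_Spaces.linear scale scale "\<rho> i x" using linear_\<rho> i xy Dc by blast
    interpret y: Vector_Spaces.linear scale scale "\<rho> i y" using linear_\<rho> i xy Dc by blast
    define a b where "a = \<rho> i x v - v" and "b = \<rho> i y v - v"
    have "a \<in> U" "b \<in> U" using xy v D by (auto simp: a_def b_def section_kernel_def)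
    then have "\<rho> i x b - b \<in> W" "\<rho> i y a - a \<in> W"
      using xy D by (auto simp: section_kernel_def)
    then have "(\<rho> i x b - b) - (\<rho> i y a - a) \<in> W"
      by (rule subspace_diff[OF sub(1)])
    then show ?thesis by (simp add: a_def b_def x.diff y.diff algebra_simps)
  qed
  then have "derived (G i) D \<subseteq> section_kernel i W V"
    by (rule derived_subset_section_kernel[OF i sub(1) V Dc])
  then show ?thesis
    unfolding solvable_section_def by (intro exI[of _ "Suc (m + n)"]) (simp add: D_def)
qed

text \<open>An irreducible section has relative dimension at least \<open>2 ^ card S \<ge> 2 * card S\<close>, since a commutative
action is solvable. If there is a stable \<open>U\<close> strictly between \<open>W\<close> and \<open>V\<close>, every index in \<open>S\<close> is
nonsolvable on \<open>(W, U)\<close> or on \<open>(U, V)\<close>, and the bounds for these two sections add up.\<close>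

lemma dim_nonsolvable_section:
  assumes "finite S" "S \<subseteq> I" "subspace W" "subspace V" "W \<subseteq> V" "V \<subseteq> span F"
    and "stable S W" "stable S V"
    and "\<And>i. i \<in> S \<Longrightarrow> \<not> solvable_section i W V"
  shows "dim W + 2 * card S \<le> dim V"
  using assms
proof (induction "dim V - dim W" arbitrary: S W V rule: less_induct)
  case less
  note sub = \<open>subspace W\<close> \<open>subspace V\<close> \<open>V \<subseteq> span F\<close>
  have stab_i: "stable {i} V" if "i \<in> S" for i
    using less.prems(8) that by (simp add: stable_def)
  consider "S = {}" | "W = V" "S \<noteq> {}" | "irreducible_section S W V"
    | U where "subspace U" "W \<subset> U" "U \<subset> V" "stable S U"
    using less.prems(5) unfolding irreducible_section_def by (metis psubset_eq)
  then show ?case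
  proof cases
    case 1
    then show ?thesis using dim_mono_finite[OF sub(3,1) less.prems(5)] by simp
  next
    case 2
    then obtain i where i: "i \<in> S" by blast
    have "\<rho> i x v - v \<in> V" if "x \<in> carrier (G i)" "v \<in> V" for x v
      using \<rho>_stable[OF less.prems(8) i that] that sub(2) by (simp add: subspace_diff)
    then have "solvable_section i W V"
      unfolding solvable_section_def using 2
      by (intro exI[of _ 0]) (auto simp: section_kernel_def)
    then show ?thesis using less.prems(9) i by blast
  next
    case 3
    have "\<not> commutative_section i W V" if "i \<in> S" for i
      using commutative_imp_solvable_section[of i W V] less.prems(9)[OF that] that less.prems(2) sub stab_i
      by blast
    then have "dim W + 2 ^ card S \<le> dim V"
      using dim_irreducible_noncommutative[OF less.prems(1,2) sub less.prems(7,8) 3] by blast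
    moreover have "2 * k \<le> 2 ^ k" for k :: nat
    proof (cases k)
      case (Suc m)
      then show ?thesis
        using mult_le_mono2[OF Suc_leI[OF less_exp[of m]], of 2] by (simp only: power_Suc)
    qed simp
    ultimately show ?thesis using order_trans add_le_mono by (metis le_refl)
  next
    case (4 U)
    define S1 S2 where "S1 = {i \<in> S. \<not> solvable_section i W U}"
      and "S2 = {i \<in> S. \<not> solvable_section i U V}"
    have lt: "dim W < dim U" "dim U < dim V"
      using dim_strict_mono 4 sub by auto
    have "S \<subseteq> S1 \<union> S2"
      using solvable_section_extension[OF _ sub(1) 4(1) sub(3) stab_i] less.prems(2,9)
      by (auto simp: S1_def S2_def)
    then have "card S \<le> card S1 + card S2"
      using less.prems(1) card_mono[of "S1 \<union> S2" S] card_Un_le[of S1 S2]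
      by (auto simp: S1_def S2_def intro: order_trans)
    moreover have "dim W + 2 * card S1 \<le> dim U"
      using less.prems 4 lt by (intro less.hyps) (auto simp: S1_def stable_def)
    moreover have "dim U + 2 * card S2 \<le> dim V"
      using less.prems 4 lt by (intro less.hyps) (auto simp: S2_def stable_def)
    ultimately show ?thesis by simp
  qed
qed

end

section \<open>Representations of direct products\<close>

lemma GL_simps:
  shows carrier_GL: "A \<in> carrier (GL TYPE('k::field) d) \<Longrightarrow> A \<in> carrier_mat d d"
    and mult_GL: "A \<otimes>\<^bsub>GL TYPE('k) d\<^esub> B = A * B"
    and one_GL: "\<one>\<^bsub>GL TYPE('k) d\<^esub> = 1\<^sub>m d"
  by (auto simp: GL_def units_of_def Units_def ring_mat_def)

text \<open>Restricting a faithful representation of the product to each factor, and extending scalars to the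
algebraic closure, gives pairwise commuting faithful representations of the factors of the same
dimension.\<close>

lemma faithful_product_representation_over_closure:
  fixes G :: "nat \<Rightarrow> ('a, 'b) monoid_scheme" and \<rho> :: "(nat \<Rightarrow> 'a) \<Rightarrow> 'k::field mat"
  assumes group: "\<And>i. i \<in> J \<Longrightarrow> group (G i)"
    and faithful: "faithful_representation TYPE('k) (product_group J G) d \<rho>"
  obtains M :: "nat \<Rightarrow> 'a \<Rightarrow> 'k alg_closure mat" where
    "\<And>i x. i \<in> J \<Longrightarrow> x \<in> carrier (G i) \<Longrightarrow> M i x \<in> carrier_mat d d"
    "\<And>i x y. i \<in> J \<Longrightarrow> x \<in> carrier (G i) \<Longrightarrow> y \<in> carrier (G i) \<Longrightarrow> M i (x \<otimes>\<^bsub>G i\<^esub> y) = M i x * M i y"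
    "\<And>i. i \<in> J \<Longrightarrow> M i \<one>\<^bsub>G i\<^esub> = 1\<^sub>m d"
    "\<And>i. i \<in> J \<Longrightarrow> inj_on (M i) (carrier (G i))"
    "\<And>i j x y. i \<in> J \<Longrightarrow> j \<in> J \<Longrightarrow> i \<noteq> j \<Longrightarrow> x \<in> carrier (G i) \<Longrightarrow> y \<in> carrier (G j) \<Longrightarrow>
      M i x * M j y = M j y * M i x"
proof
  define embed where "embed i x = (\<lambda>j\<in>J. if j = i then x else \<one>\<^bsub>G j\<^esub>)" for i x
  define M where "M i x = map_mat to_ac (\<rho> (embed i x))" for i x
  let ?P = "product_group J G"
  have hom: "\<rho> \<in> hom ?P (GL TYPE('k) d)" and inj: "inj_on \<rho> (carrier ?P)"
    using faithful by (auto simp: faithful_representation_def)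
  interpret ac: semiring_hom "to_ac :: 'k \<Rightarrow> 'k alg_closure"
    by unfold_locales auto
  have one: "\<one>\<^bsub>G i\<^esub> \<in> carrier (G i)" "\<one>\<^bsub>G i\<^esub> \<otimes>\<^bsub>G i\<^esub> \<one>\<^bsub>G i\<^esub> = \<one>\<^bsub>G i\<^esub>" if "i \<in> J" for i
  proof -
    interpret G: group "G i" using group[OF that] .
    show "\<one>\<^bsub>G i\<^esub> \<in> carrier (G i)" "\<one>\<^bsub>G i\<^esub> \<otimes>\<^bsub>G i\<^esub> \<one>\<^bsub>G i\<^esub> = \<one>\<^bsub>G i\<^esub>" by auto
  qed
  have unit: "\<one>\<^bsub>G i\<^esub> \<otimes>\<^bsub>G i\<^esub> x = x" "x \<otimes>\<^bsub>G i\<^esub> \<one>\<^bsub>G i\<^esub> = x" if "i \<in> J" "x \<in> carrier (G i)" for i x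
    using group[OF that(1)] that(2) by (simp_all add: group.is_monoid monoid.l_one monoid.r_one)
  have embed: "embed i x \<in> carrier ?P" if "i \<in> J" "x \<in> carrier (G i)" for i x
    using that one by (auto simp: embed_def)
  have carrier: "\<rho> f \<in> carrier_mat d d" if "f \<in> carrier ?P" for f
    using hom_in_carrier[OF hom that] by (rule carrier_GL)
  have mult: "\<rho> (f \<otimes>\<^bsub>?P\<^esub> g) = \<rho> f * \<rho> g" if "f \<in> carrier ?P" "g \<in> carrier ?P" for f g
    using hom_mult[OF hom that] by (simp add: mult_GL)
  have M_mult: "M i x * M j y = map_mat to_ac (\<rho> (embed i x \<otimes>\<^bsub>?P\<^esub> embed j y))"
    if "i \<in> J" "x \<in> carrier (G i)" "j \<in> J" "y \<in> carrier (G j)" for i j x y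
    unfolding M_def using ac.mat_hom_mult[OF carrier carrier] mult embed that by metis
  show "M i x \<in> carrier_mat d d" if "i \<in> J" "x \<in> carrier (G i)" for i x
    using carrier[OF embed[OF that]] by (simp add: M_def)
  show "M i (x \<otimes>\<^bsub>G i\<^esub> y) = M i x * M i y"
    if "i \<in> J" "x \<in> carrier (G i)" "y \<in> carrier (G i)" for i x y
  proof -
    have "embed i x \<otimes>\<^bsub>?P\<^esub> embed i y = embed i (x \<otimes>\<^bsub>G i\<^esub> y)"
      using one by (auto simp: embed_def)
    then show ?thesis using M_mult[of i x i y] that by (simp add: M_def del: mult_product_group)
  qed
  show "M i \<one>\<^bsub>G i\<^esub> = 1\<^sub>m d" if "i \<in> J" for i
  proof -
    have "embed i \<one>\<^bsub>G i\<^esub> = \<one>\<^bsub>?P\<^esub>" by (auto simp: embed_def)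
    moreover have "\<rho> \<one>\<^bsub>?P\<^esub> = \<one>\<^bsub>GL TYPE('k) d\<^esub>"
      using hom_one[OF hom product_group[OF group] group_GL] by blast
    ultimately show ?thesis by (simp add: M_def one_GL ac.mat_hom_one del: one_product_group)
  qed
  show "inj_on (M i) (carrier (G i))" if "i \<in> J" for i
  proof (rule inj_onI)
    fix x y assume xy: "x \<in> carrier (G i)" "y \<in> carrier (G i)" and eq: "M i x = M i y"
    have "\<rho> (embed i x) = \<rho> (embed i y)"
    proof (rule eq_matI)
      fix r s assume rs: "r < dim_row (\<rho> (embed i y))" "s < dim_col (\<rho> (embed i y))"
      have "M i x $$ (r, s) = M i y $$ (r, s)" using eq by simp
      then show "\<rho> (embed i x) $$ (r, s) = \<rho> (embed i y) $$ (r, s)"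
        using rs carrier[OF embed[OF that xy(1)]] carrier[OF embed[OF that xy(2)]] by (simp add: M_def)
    qed (use carrier[OF embed[OF that xy(1)]] carrier[OF embed[OF that xy(2)]] in auto)
    then have "embed i x = embed i y"
      using inj embed that xy by (meson inj_onD)
    then have "embed i x i = embed i y i" by simp
    then show "x = y" using that by (simp add: embed_def)
  qed
  show "M i x * M j y = M j y * M i x"
    if "i \<in> J" "j \<in> J" "i \<noteq> j" "x \<in> carrier (G i)" "y \<in> carrier (G j)" for i j x y
  proof -
    have "embed i x \<otimes>\<^bsub>?P\<^esub> embed j y = embed j y \<otimes>\<^bsub>?P\<^esub> embed i x"
      using that one unit by (auto simp: embed_def)
    then show ?thesis using that by (simp add: M_mult del: mult_product_group)
  qed
qed

text \<open>The noncommuting pairs are the images of a pair of noncommuting elements from each factor.\<close>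

lemma dim_ge_of_nonabelian:
  fixes G :: "nat \<Rightarrow> ('a, 'b) monoid_scheme" and \<rho> :: "(nat \<Rightarrow> 'a) \<Rightarrow> 'k::field mat"
  assumes J: "finite J" "J \<noteq> {}" and group: "\<And>i. i \<in> J \<Longrightarrow> group (G i)"
    and faithful: "faithful_representation TYPE('k) (product_group J G) d \<rho>"
    and nonabelian: "\<And>i. i \<in> J \<Longrightarrow> \<not> comm_group (G i)"
  shows "card J + 1 \<le> d"
proof -
  obtain M :: "nat \<Rightarrow> 'a \<Rightarrow> 'k alg_closure mat" where
    M: "\<And>i x. i \<in> J \<Longrightarrow> x \<in> carrier (G i) \<Longrightarrow> M i x \<in> carrier_mat d d"
    and M_mult: "\<And>i x y. i \<in> J \<Longrightarrow> x \<in> carrier (G i) \<Longrightarrow> y \<in> carrier (G i) \<Longrightarrow> M i (x \<otimes>\<^bsub>G i\<^esub> y) = M i x * M i y"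
    and M_inj: "\<And>i. i \<in> J \<Longrightarrow> inj_on (M i) (carrier (G i))"
    and M_comm: "\<And>i j x y. i \<in> J \<Longrightarrow> j \<in> J \<Longrightarrow> i \<noteq> j \<Longrightarrow> x \<in> carrier (G i) \<Longrightarrow> y \<in> carrier (G j) \<Longrightarrow>
      M i x * M j y = M j y * M i x"
    by (rule faithful_product_representation_over_closure[OF group faithful]) blast+
  have "\<exists>x y. x \<in> carrier (G i) \<and> y \<in> carrier (G i) \<and> x \<otimes>\<^bsub>G i\<^esub> y \<noteq> y \<otimes>\<^bsub>G i\<^esub> x" if "i \<in> J" for i
    using group.group_comm_groupI[OF group[OF that]] nonabelian[OF that] by blast
  then obtain a b where ab: "\<And>i. i \<in> J \<Longrightarrow> a i \<in> carrier (G i)" "\<And>i. i \<in> J \<Longrightarrow> b i \<in> carrier (G i)"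
    "\<And>i. i \<in> J \<Longrightarrow> a i \<otimes>\<^bsub>G i\<^esub> b i \<noteq> b i \<otimes>\<^bsub>G i\<^esub> a i"
    by metis
  have noncomm: "M i (a i) * M i (b i) \<noteq> M i (b i) * M i (a i)" if i: "i \<in> J" for i
  proof -
    interpret G: group "G i" using group[OF i] .
    have "M i (a i \<otimes>\<^bsub>G i\<^esub> b i) \<noteq> M i (b i \<otimes>\<^bsub>G i\<^esub> a i)"
      using inj_onD[OF M_inj[OF i]] ab i by blast
    then show ?thesis using M_mult[OF i] ab i by simp
  qed
  have "card J < d"
    by (rule card_noncommuting_pairs_less_dim[of J "\<lambda>i. M i (a i)" d "\<lambda>i. M i (b i)"])
       (use J ab M M_comm noncomm infinite_UNIV_alg_closed_field in auto)
  then show ?thesis by simp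
qed

lemma sum_apply: "(\<Sum>x\<in>A. f x) r = (\<Sum>x\<in>A. f x r)"
  for f :: "'i \<Rightarrow> nat \<Rightarrow> 'k::field"
  by (induction A rule: infinite_finite_induct) auto

text \<open>Column vectors of length \<open>d\<close> are represented by sequences that vanish from index \<open>d\<close> on. Entries
of the argument outside the format of the matrix are ignored and the result is padded with zeros,
so the action is linear on all sequences, although the identity matrix acts as the identity only on
the padded vectors.\<close>

definition mat_action :: "'k::field mat \<Rightarrow> (nat \<Rightarrow> 'k) \<Rightarrow> nat \<Rightarrow> 'k"
  where "mat_action A f = (\<lambda>r. if r < dim_row A then \<Sum>s<dim_col A. A $$ (r, s) * f s else 0)"

lemma mat_action_mult:
  assumes "A \<in> carrier_mat d d" "B \<in> carrier_mat d d"
  shows "mat_action (A * B) f = mat_action A (mat_action B f)"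
proof
  fix r
  show "mat_action (A * B) f r = mat_action A (mat_action B f) r"
  proof (cases "r < d")
    case True
    have "(\<Sum>s<d. (A * B) $$ (r, s) * f s) = (\<Sum>s<d. \<Sum>l<d. A $$ (r, l) * (B $$ (l, s) * f s))"
      using True by (intro sum.cong refl)
        (simp add: index_mult_mat_sum[OF assms] sum_distrib_right mult.assoc)
    also have "\<dots> = (\<Sum>l<d. A $$ (r, l) * (\<Sum>s<d. B $$ (l, s) * f s))"
      by (subst sum.swap) (simp add: sum_distrib_left)
    finally show ?thesis using assms True by (auto simp: mat_action_def)
  qed (use assms in \<open>auto simp: mat_action_def\<close>)
qed

text \<open>By faithfulness, a factor that acts solvably on the section \<open>({0}, V)\<close>, where \<open>V\<close> is the whole
representation space, has a trivial term in its derived series.\<close>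

lemma dim_ge_of_nonsolvable:
  fixes G :: "nat \<Rightarrow> ('a, 'b) monoid_scheme" and \<rho> :: "(nat \<Rightarrow> 'a) \<Rightarrow> 'k::field mat"
  assumes J: "finite J" and group: "\<And>i. i \<in> J \<Longrightarrow> group (G i)"
    and faithful: "faithful_representation TYPE('k) (product_group J G) d \<rho>"
    and nonsolvable: "\<And>i. i \<in> J \<Longrightarrow> \<not> solvable (G i)"
  shows "2 * card J \<le> d"
proof -
  obtain M :: "nat \<Rightarrow> 'a \<Rightarrow> 'k alg_closure mat" where
    M: "\<And>i x. i \<in> J \<Longrightarrow> x \<in> carrier (G i) \<Longrightarrow> M i x \<in> carrier_mat d d"
    and M_mult: "\<And>i x y. i \<in> J \<Longrightarrow> x \<in> carrier (G i) \<Longrightarrow> y \<in> carrier (G i) \<Longrightarrow> M i (x \<otimes>\<^bsub>G i\<^esub> y) = M i x * M i y"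
    and M_one: "\<And>i. i \<in> J \<Longrightarrow> M i \<one>\<^bsub>G i\<^esub> = 1\<^sub>m d"
    and M_inj: "\<And>i. i \<in> J \<Longrightarrow> inj_on (M i) (carrier (G i))"
    and M_comm: "\<And>i j x y. i \<in> J \<Longrightarrow> j \<in> J \<Longrightarrow> i \<noteq> j \<Longrightarrow> x \<in> carrier (G i) \<Longrightarrow> y \<in> carrier (G j) \<Longrightarrow>
      M i x * M j y = M j y * M i x"
    by (rule faithful_product_representation_over_closure[OF group faithful]) blast+
  define scale :: "'k alg_closure \<Rightarrow> (nat \<Rightarrow> 'k alg_closure) \<Rightarrow> nat \<Rightarrow> 'k alg_closure"
    where "scale c f = (\<lambda>r. c * f r)" for c f
  define e :: "nat \<Rightarrow> nat \<Rightarrow> 'k alg_closure" where "e s = (\<lambda>r. if r = s then 1 else 0)" for s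
  interpret V: vector_space scale
    by unfold_locales (auto simp: scale_def fun_eq_iff algebra_simps)
  interpret V: ambient_space scale "e ` {..<d}"
    by unfold_locales simp
  have supp: "f r = 0" if f: "f \<in> V.span (e ` {..<d})" and r: "\<not> r < d" for f r
    using f
  proof (induction rule: V.span_induct_alt)
    case (step c x y)
    then show ?case using r by (auto simp: scale_def e_def)
  qed simp
  have linear: "Vector_Spaces.linear scale scale (mat_action A)" for A
    unfolding Vector_Spaces.linear_iff
    using V.vector_space_axioms
    by (auto simp: scale_def mat_action_def fun_eq_iff sum.distrib sum_distrib_left algebra_simps)
  have act_one: "mat_action (1\<^sub>m d) f = f" if f: "f \<in> V.span (e ` {..<d})" for f
  proof
    fix r
    have "(\<Sum>s<d. 1\<^sub>m d $$ (r, s) * f s) = f r" if "r < d"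
    proof -
      have "(\<Sum>s<d. 1\<^sub>m d $$ (r, s) * f s) = (\<Sum>s<d. if s = r then f s else 0)"
        using that by (intro sum.cong) auto
      then show ?thesis using that by simp
    qed
    then show "mat_action (1\<^sub>m d) f r = f r"
      using supp[OF f] by (auto simp: mat_action_def)
  qed
  interpret V: commuting_group_actions scale "e ` {..<d}" J G "\<lambda>i x. mat_action (M i x)"
  proof (intro commuting_group_actions.intro V.ambient_space_axioms commuting_group_actions_axioms.intro)
    fix i j x y v
    assume "i \<in> J" "j \<in> J" "i \<noteq> j" "x \<in> carrier (G i)" "y \<in> carrier (G j)"
    then show "mat_action (M i x) (mat_action (M j y) v) = mat_action (M j y) (mat_action (M i x) v)"
      using M_comm M by (metis mat_action_mult)
  next
    fix i x y v assume "i \<in> J" "x \<in> carrier (G i)" "y \<in> carrier (G i)"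
    then show "mat_action (M i (x \<otimes>\<^bsub>G i\<^esub> y)) v = mat_action (M i x) (mat_action (M i y) v)"
      using M_mult M by (metis mat_action_mult)
  qed (use group linear M_one act_one in auto)
  let ?E = "V.span (e ` {..<d})"
  have mat_action_mem: "mat_action A f \<in> ?E" if A: "A \<in> carrier_mat d d" for A f
  proof -
    have "mat_action A f = (\<Sum>s<d. scale (mat_action A f s) (e s))"
    proof
      fix r
      have "(\<Sum>s<d. scale (mat_action A f s) (e s)) r = (\<Sum>s<d. if s = r then mat_action A f s else 0)"
        unfolding sum_apply by (intro sum.cong) (auto simp: scale_def e_def)
      also have "\<dots> = mat_action A f r"
        using A by (auto simp: mat_action_def)
      finally show "mat_action A f r = (\<Sum>s<d. scale (mat_action A f s) (e s)) r" ..
    qed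
    also have "\<dots> \<in> ?E"
      by (intro V.subspace_sum V.subspace_scale V.span_base) auto
    finally show ?thesis .
  qed
  have "V.dim {0} + 2 * card J \<le> V.dim ?E"
  proof (rule V.dim_nonsolvable_section[OF J order_refl])
    show "V.stable J {0}"
      using linear by (auto simp: V.stable_def Vector_Spaces.linear_iff mat_action_def fun_eq_iff)
    show "V.stable J ?E" using mat_action_mem M by (auto simp: V.stable_def)
    fix i assume i: "i \<in> J"
    interpret G: group "G i" using group[OF i] .
    show "\<not> V.solvable_section i {0} ?E"
    proof
      assume "V.solvable_section i {0} ?E"
      then obtain m where m: "(derived (G i) ^^ m) (carrier (G i)) \<subseteq> V.section_kernel i {0} ?E"
        by (auto simp: V.solvable_section_def)
      have "V.section_kernel i {0} ?E \<subseteq> {\<one>\<^bsub>G i\<^esub>}"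
      proof
        fix x assume x: "x \<in> V.section_kernel i {0} ?E"
        then have xc: "x \<in> carrier (G i)" by (simp add: V.section_kernel_def)
        have "M i x = 1\<^sub>m d"
        proof (rule eq_matI)
          fix r s assume rs: "r < dim_row (1\<^sub>m d)" "s < dim_col (1\<^sub>m d)"
          have "mat_action (M i x) (e s) = e s"
            using x rs by (auto simp: V.section_kernel_def V.span_base)
          then have "mat_action (M i x) (e s) r = e s r" by simp
          moreover have "mat_action (M i x) (e s) r = (\<Sum>t<d. if t = s then M i x $$ (r, t) else 0)"
            using M[OF i xc] rs by (simp add: mat_action_def e_def if_distrib cong: if_cong)
          ultimately show "M i x $$ (r, s) = 1\<^sub>m d $$ (r, s)"
            using rs by (auto simp: e_def)
        qed (use M[OF i xc] in auto)
        then show "x \<in> {\<one>\<^bsub>G i\<^esub>}"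
          using M_inj[OF i] M_one[OF i] xc by (metis G.one_closed inj_onD singletonI)
      qed
      moreover have "\<one>\<^bsub>G i\<^esub> \<in> (derived (G i) ^^ m) (carrier (G i))"
        using G.exp_of_derived_is_subgroup[OF G.subgroup_self] subgroup.one_closed by blast
      ultimately have "(derived (G i) ^^ m) (carrier (G i)) = {\<one>\<^bsub>G i\<^esub>}" using m by blast
      then show False
        using nonsolvable[OF i] G.solvable_iff_trivial_derived_seq by blast
    qed
  qed (auto simp: V.subspace_0)
  moreover have "V.dim ?E \<le> d"
    using V.dim_le_card[of ?E "e ` {..<d}"] card_image_le[of "{..<d}" e] by simp
  ultimately show ?thesis by linarith
qed

theorem theorem3:
  fixes G :: "nat \<Rightarrow> ('a, 'b) monoid_scheme" and n :: nat
  assumes "n \<ge> 1"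
    and "\<And>i. i \<in> {1..n} \<Longrightarrow> group (G i)"
  shows "((\<forall>i\<in>{1..n}. \<not> comm_group (G i)) \<longrightarrow>
            mu TYPE('k::field) (product_group {1..n} G) \<ge> enat (n + 1)) \<and>
         ((\<forall>i\<in>{1..n}. \<not> solvable (G i)) \<longrightarrow>
            mu TYPE('k) (product_group {1..n} G) \<ge> enat (2 * n))"
proof (intro conjI impI)
  assume "\<forall>i\<in>{1..n}. \<not> comm_group (G i)"
  then have "n + 1 \<le> d"
    if "faithful_representation TYPE('k) (product_group {1..n} G) d \<rho>" for d \<rho>
    using dim_ge_of_nonabelian[OF _ _ assms(2) that] assms(1) by simp
  then show "mu TYPE('k) (product_group {1..n} G) \<ge> enat (n + 1)"
    unfolding mu_def by (intro Inf_greatest) auto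
next
  assume "\<forall>i\<in>{1..n}. \<not> solvable (G i)"
  then have "2 * n \<le> d"
    if "faithful_representation TYPE('k) (product_group {1..n} G) d \<rho>" for d \<rho>
    using dim_ge_of_nonsolvable[OF _ assms(2) that] by simp
  then show "mu TYPE('k) (product_group {1..n} G) \<ge> enat (2 * n)"
    unfolding mu_def by (intro Inf_greatest) auto
qed

end
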